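(* Let $(M,g)$ be the Robinson–Trautman spacetime with coordinates $(t,r,x,y)$, constants $a,b,d\in\mathbb R$ and function $f=f(x,y)$, and let $F_1=f_x^2+f_y^2-f(f_{xx}+f_{yy})$. If $b=0$ and $F_1-2a+4br\neq0$ on $M$, then for all constants $\mu_1,\mu_2\in\mathbb R$ the spacetime possesses Ricci inheritance with respect to $\xi=\mu_1\frac{\partial}{\partial x}+\mu_2\frac{\partial}{\partial y}$, given by $$\mathscr L_\xi S=\frac{\mu_2F_{13}+\mu_1F_{11}}{f(F_1-2a+4br)}\,S,$$ where $$F_{13}=-2f_y^3+f_y\{4a-16br-2f_x^2+f(3f_{yy}+f_{xx})\}-f\{-2f_xf_{xy}+f(f_{yyy}+f_{xxy})\},$$ $$F_{11}=-2f_x^3+f_x\{4a-16br-2f_y^2+f(f_{yy}+3f_{xx})\}-f\{-2f_yf_{xy}+f(f_{xxx}+f_{xyy})\}.$$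
   Context: Robinson–Trautman (RT) spacetime: $a,b,d\in\mathbb R$ are constants; $M=I\times J\times\Omega$ with coordinates $(x^1,x^2,x^3,x^4)=(t,r,x,y)$, where $I\subset\mathbb R$ and $J\subset\mathbb R\setminus\{0\}$ are open intervals and $\Omega\subset\mathbb R^2$ is open, connected and nonempty; $f:\Omega\to\mathbb R$ is smooth and nowhere vanishing, with subscripts denoting partial derivatives; the metric is $$g=-2\Big(a-2br-\frac dr\Big)dt^2+2\,dt\,dr-\frac{r^2}{f^2}(dx^2+dy^2).$$ ($2\,dt\,dr$ means $g_{12}=g_{21}=1$.) Curvature conventions: with $\Gamma$ the Levi-Civita connection coefficients, $R_{pqrs}=g_{p\alpha}(\partial_r\Gamma^\alpha_{qs}-\partial_s\Gamma^\alpha_{qr}+\Gamma^\beta_{qs}\Gamma^\alpha_{\beta r}-\Gamma^\beta_{qr}\Gamma^\alpha_{\beta s})$ and $S_{qr}=g^{ps}R_{pqrs}$. With this convention the nonzero components of $S$ (up to symmetry) are $S_{11}=-\frac{8b(d+r(-a+2br))}{r^2}$, $S_{12}=-\frac{4b}{r}$, $S_{33}=S_{44}=\frac{F_1-2a+8br}{f^2}$. Ricci inheritance with respect to $\xi$ means $\mathscr L_\xi S=\lambda S$ for a smooth function $\lambda$, where $\mathscr L_\xi$ is the Lie derivative. *)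

theory Defs
  imports "HOL-Analysis.Analysis"
begin

text \<open>All fields are total functions of the coordinates; on an open set the operators below only
  depend on the values of the fields on that set.\<close>

definition partial :: "'n::finite \<Rightarrow> (real^'n \<Rightarrow> real) \<Rightarrow> real^'n \<Rightarrow> real" where
  "partial i u p = deriv (\<lambda>s. u (p + s *\<^sub>R axis i 1)) 0"

primrec Ck_on :: "nat \<Rightarrow> (real^'n::finite) set \<Rightarrow> (real^'n \<Rightarrow> real) \<Rightarrow> bool" where
  "Ck_on 0 U u \<longleftrightarrow> continuous_on U u"
| "Ck_on (Suc k) U u \<longleftrightarrow>
     (\<forall>p\<in>U. u differentiable (at p)) \<and> (\<forall>i. Ck_on k U (partial i u))"

text \<open>Intended for open \<open>U\<close>.\<close>
definition smooth_on :: "(real^'n::finite) set \<Rightarrow> (real^'n \<Rightarrow> real) \<Rightarrow> bool" where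
  "smooth_on U u \<longleftrightarrow> (\<forall>k. Ck_on k U u)"

text \<open>Covariant tensor fields of rank two and metrics are given by their matrix of components
  with respect to the coordinates.\<close>

type_synonym 'n tensor2 = "real^'n \<Rightarrow> real^'n^'n"

definition ginv :: "'n::finite tensor2 \<Rightarrow> 'n tensor2" where
  "ginv g p = matrix_inv (g p)"

text \<open>\<open>christoffel g k i j\<close> is the component with upper index \<open>k\<close> and lower indices \<open>i\<close>, \<open>j\<close>.\<close>
definition christoffel :: "'n::finite tensor2 \<Rightarrow> 'n \<Rightarrow> 'n \<Rightarrow> 'n \<Rightarrow> real^'n \<Rightarrow> real" where
  "christoffel g k i j p =
     1/2 * (\<Sum>l\<in>UNIV. ginv g p $ k $ l *
       (partial i (\<lambda>p. g p $ j $ l) p + partial j (\<lambda>p. g p $ i $ l) p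
        - partial l (\<lambda>p. g p $ i $ j) p))"

definition riemann :: "'n::finite tensor2 \<Rightarrow> 'n \<Rightarrow> 'n \<Rightarrow> 'n \<Rightarrow> 'n \<Rightarrow> real^'n \<Rightarrow> real" where
  "riemann g h q r s p =
     (\<Sum>\<alpha>\<in>UNIV. g p $ h $ \<alpha> *
       (partial r (christoffel g \<alpha> q s) p - partial s (christoffel g \<alpha> q r) p
        + (\<Sum>\<beta>\<in>UNIV. christoffel g \<beta> q s p * christoffel g \<alpha> \<beta> r p)
        - (\<Sum>\<beta>\<in>UNIV. christoffel g \<beta> q r p * christoffel g \<alpha> \<beta> s p)))"

text \<open>The contraction is over the first and last index, so this is the negative of the tensor
  obtained by contracting the first and third index.\<close>
definition ricci :: "'n::finite tensor2 \<Rightarrow> 'n tensor2" where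
  "ricci g p = (\<chi> q r. \<Sum>h\<in>UNIV. \<Sum>s\<in>UNIV. ginv g p $ h $ s * riemann g h q r s p)"

definition lie_derivative :: "(real^'n \<Rightarrow> real^'n) \<Rightarrow> 'n::finite tensor2 \<Rightarrow> 'n tensor2" where
  "lie_derivative \<xi> T p =
     (\<chi> i j. \<Sum>k\<in>UNIV. \<xi> p $ k * partial k (\<lambda>p. T p $ i $ j) p
        + T p $ k $ j * partial i (\<lambda>p. \<xi> p $ k) p
        + T p $ i $ k * partial j (\<lambda>p. \<xi> p $ k) p)"

text \<open>Ricci inheritance of \<open>(U, g)\<close> with respect to \<open>\<xi>\<close>, with inheritance factor \<open>lam\<close>.\<close>
definition ricci_inheritance ::
  "(real^'n::finite) set \<Rightarrow> 'n tensor2 \<Rightarrow> (real^'n \<Rightarrow> real^'n) \<Rightarrow> (real^'n \<Rightarrow> real) \<Rightarrow> bool" where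
  "ricci_inheritance U g \<xi> lam \<longleftrightarrow> smooth_on U lam \<and>
     (\<forall>p\<in>U. lie_derivative \<xi> (ricci g) p = lam p *\<^sub>R ricci g p)"

text \<open>Coordinates \<open>(t, r, x, y)\<close> are the components \<open>1, 2, 3, 4\<close>; note that the index \<open>4 :: 4\<close>
  equals \<open>0\<close>. The function \<open>f\<close> is a function of \<open>(x, y)\<close>, whose indices are \<open>1, 2 :: 2\<close>.\<close>

definition xy :: "real^4 \<Rightarrow> real^2" where
  "xy p = vector [p $ 3, p $ 4]"

definition rt_domain :: "real set \<Rightarrow> real set \<Rightarrow> (real^2) set \<Rightarrow> (real^4) set" where
  "rt_domain I J \<Omega> = {p. p $ 1 \<in> I \<and> p $ 2 \<in> J \<and> xy p \<in> \<Omega>}"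

definition rt_metric :: "real \<Rightarrow> real \<Rightarrow> real \<Rightarrow> (real^2 \<Rightarrow> real) \<Rightarrow> 4 tensor2" where
  "rt_metric a b d f p =
     (let r = p $ 2; h = - (r\<^sup>2 / (f (xy p))\<^sup>2) in
      vector [vector [- 2 * (a - 2 * b * r - d / r), 1, 0, 0],
              vector [1, 0, 0, 0],
              vector [0, 0, h, 0],
              vector [0, 0, 0, h]])"

lemma vector_4 [simp]:
  "(vector [w, x, y, z] :: ('a::zero)^4) $ 1 = w"
  "(vector [w, x, y, z] :: ('a::zero)^4) $ 2 = x"
  "(vector [w, x, y, z] :: ('a::zero)^4) $ 3 = y"
  "(vector [w, x, y, z] :: ('a::zero)^4) $ 4 = z"
  unfolding vector_def by simp_all

abbreviation dx :: "(real^2 \<Rightarrow> real) \<Rightarrow> real^2 \<Rightarrow> real" where "dx \<equiv> partial 1"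
abbreviation dy :: "(real^2 \<Rightarrow> real) \<Rightarrow> real^2 \<Rightarrow> real" where "dy \<equiv> partial 2"

definition F1 :: "(real^2 \<Rightarrow> real) \<Rightarrow> real^2 \<Rightarrow> real" where
  "F1 f q = (dx f q)\<^sup>2 + (dy f q)\<^sup>2 - f q * (dx (dx f) q + dy (dy f) q)"

text \<open>Subscripts are read left to right: \<open>f\<^sub>x\<^sub>y\<close> is \<open>dy (dx f)\<close>.\<close>

definition F11 :: "real \<Rightarrow> real \<Rightarrow> (real^2 \<Rightarrow> real) \<Rightarrow> real \<Rightarrow> real^2 \<Rightarrow> real" where
  "F11 a b f r q =
     - 2 * (dx f q)^3
     + dx f q * (4 * a - 16 * b * r - 2 * (dy f q)\<^sup>2 + f q * (dy (dy f) q + 3 * dx (dx f) q))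
     - f q * (- 2 * dy f q * dy (dx f) q + f q * (dx (dx (dx f)) q + dy (dy (dx f)) q))"

definition F13 :: "real \<Rightarrow> real \<Rightarrow> (real^2 \<Rightarrow> real) \<Rightarrow> real \<Rightarrow> real^2 \<Rightarrow> real" where
  "F13 a b f r q =
     - 2 * (dy f q)^3
     + dy f q * (4 * a - 16 * b * r - 2 * (dx f q)\<^sup>2 + f q * (3 * dy (dy f) q + dx (dx f) q))
     - f q * (- 2 * dx f q * dy (dx f) q + f q * (dy (dy (dy f)) q + dy (dx (dx f)) q))"

end

theory Submission
  imports Defs
begin

text \<open>
  The field \<open>\<xi> = \<mu>\<^sub>1 \<partial>/\<partial>x + \<mu>\<^sub>2 \<partial>/\<partial>y\<close> has constant components, so \<open>\<L>\<^sub>\<xi> S\<close> is obtained by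
  differentiating the components of the Ricci tensor \<open>S\<close> in the direction \<open>\<xi>\<close>
  (\<open>lie_derivative_const\<close>). The components \<open>S\<^sub>1\<^sub>1\<close> and \<open>S\<^sub>1\<^sub>2\<close> depend only on \<open>r\<close> and are killed; there remain
  \<open>S\<^sub>3\<^sub>3 = S\<^sub>4\<^sub>4 = (F\<^sub>1 - 2 a + 8 b r) / f\<^sup>2\<close>, whose derivatives in \<open>x\<close> and \<open>y\<close> are \<open>F\<^sub>1\<^sub>1 / f\<^sup>3\<close> and
  \<open>F\<^sub>1\<^sub>3 / f\<^sup>3\<close> (\<open>partial_ricci_angular\<close>). For \<open>b = 0\<close> the components \<open>S\<^sub>1\<^sub>1\<close> and \<open>S\<^sub>1\<^sub>2\<close> themselves vanish, and
  \<open>S = (F\<^sub>1 - 2 a) / f\<^sup>2 (dx\<^sup>2 + dy\<^sup>2)\<close>. Then \<open>S\<close> and \<open>\<L>\<^sub>\<xi> S\<close> are both multiples of \<open>dx\<^sup>2 + dy\<^sup>2\<close>, and the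
  inheritance factor is the quotient of their coefficients.

  The Ricci tensor is computed in \<open>ricci_eq\<close> for arbitrary \<open>b\<close>. All fields involved are functions of \<open>r\<close> and
  of the point \<open>q = (x, y)\<close>, so their derivatives reduce to derivatives in \<open>r\<close> for fixed \<open>q\<close> and in \<open>q\<close> for
  fixed \<open>r\<close> (\<open>partial_r_xy\<close>); the Christoffel symbols and their derivatives are tabulated as matrices.
  Two facts of calculus enter: Schwarz's theorem on mixed derivatives (\<open>partial_commute\<close>), needed both for the
  vanishing of \<open>S\<^sub>3\<^sub>4\<close> and for the identification of \<open>F\<^sub>1\<^sub>1\<close>, and the closure of smooth functions under the
  field operations, needed for the smoothness of the inheritance factor.
\<close>

section \<open>Partial derivatives\<close>

text \<open>On a coordinate line, \<open>partial\<close> is the derivative at every parameter \<open>s\<close> and not only at \<open>0\<close>, as the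
  mean value theorem requires.\<close>

lemma has_partial:
  assumes "u differentiable (at (p + s *\<^sub>R axis i 1))"
  shows "((\<lambda>s. u (p + s *\<^sub>R axis i 1)) has_real_derivative partial i u (p + s *\<^sub>R axis i 1)) (at s)"
proof -
  define q where "q = p + s *\<^sub>R axis i (1::real)"
  have "(u \<circ> (\<lambda>h. q + h *\<^sub>R axis i 1)) differentiable (at 0)"
    using assms unfolding q_def[symmetric]
    by (intro differentiable_chain_at differentiable_add differentiable_scaleR
        differentiable_const differentiable_ident) simp
  then have "((\<lambda>h. u (q + h *\<^sub>R axis i 1)) has_real_derivative partial i u q) (at 0)"
    unfolding partial_def by (simp add: DERIV_deriv_iff_real_differentiable o_def)
  moreover have "(\<lambda>h. u (q + h *\<^sub>R axis i 1)) = (\<lambda>h. u (p + (h + s) *\<^sub>R axis i 1))"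
    by (simp add: q_def algebra_simps)
  ultimately have "((\<lambda>h. u (p + (h + s) *\<^sub>R axis i 1)) has_real_derivative partial i u q) (at 0)"
    by simp
  then show ?thesis
    using DERIV_shift[of "\<lambda>h. u (p + h *\<^sub>R axis i 1)" "partial i u q" 0 s]
    by (simp add: q_def)
qed

lemma has_partial_0:
  assumes "u differentiable (at p)"
  shows "((\<lambda>s. u (p + s *\<^sub>R axis i 1)) has_real_derivative partial i u p) (at 0)"
  using has_partial[of u p 0 i] assms by simp

lemma partial_eqI:
  "((\<lambda>s. u (p + s *\<^sub>R axis i 1)) has_real_derivative D) (at 0) \<Longrightarrow> partial i u p = D"
  unfolding partial_def by (rule DERIV_imp_deriv)

lemma partial_const [simp]: "partial i (\<lambda>p. c) p = 0"
  by (simp add: partial_def)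

lemma partial_add:
  assumes "u differentiable (at p)" "v differentiable (at p)"
  shows "partial i (\<lambda>p. u p + v p) p = partial i u p + partial i v p"
  by (rule partial_eqI) (auto intro!: derivative_eq_intros has_partial_0 assms)

lemma partial_mult:
  assumes "u differentiable (at p)" "v differentiable (at p)"
  shows "partial i (\<lambda>p. u p * v p) p = partial i u p * v p + u p * partial i v p"
  by (rule partial_eqI) (auto intro!: derivative_eq_intros has_partial_0 assms)

lemma partial_divide:
  assumes "u differentiable (at p)" "v differentiable (at p)" "v p \<noteq> 0"
  shows "partial i (\<lambda>p. u p / v p) p = (partial i u p * v p - u p * partial i v p) / (v p)\<^sup>2"
  by (rule partial_eqI)
    (use assms(3) in \<open>auto intro!: derivative_eq_intros has_partial_0 assms simp: power2_eq_square\<close>)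

text \<open>A partial derivative only sees the germ of the function. This is what allows a field that is
  known in closed form merely on an open set to be differentiated there.\<close>

lemma partial_cong_on:
  assumes "open U" "p \<in> U" "\<And>q. q \<in> U \<Longrightarrow> u q = v q"
  shows "partial i u p = partial i v p"
proof -
  have "((\<lambda>s::real. p + s *\<^sub>R axis i 1) \<longlongrightarrow> p + 0 *\<^sub>R axis i 1) (nhds 0)"
    by (intro tendsto_intros filterlim_ident)
  then have "eventually (\<lambda>s::real. p + s *\<^sub>R axis i 1 \<in> U) (nhds 0)"
    using assms(1,2) by (auto simp: tendsto_def)
  then have "eventually (\<lambda>s. u (p + s *\<^sub>R axis i 1) = v (p + s *\<^sub>R axis i 1)) (nhds 0)"
    by eventually_elim (rule assms(3))
  then show ?thesis
    unfolding partial_def by (rule deriv_cong_ev) simp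
qed

section \<open>Smooth functions\<close>

lemma Ck_on_cong:
  assumes "open U" "\<And>q. q \<in> U \<Longrightarrow> u q = v q"
  shows "Ck_on k U u \<longleftrightarrow> Ck_on k U v"
proof -
  have "Ck_on k U v" if "\<And>q. q \<in> U \<Longrightarrow> u q = v q" "Ck_on k U u" for u v
    using that
  proof (induction k arbitrary: u v)
    case 0
    then show ?case by (simp cong: continuous_on_cong)
  next
    case (Suc k)
    have "v differentiable (at p)" if "p \<in> U" for p
    proof -
      obtain D where "(u has_derivative D) (at p)"
        using Suc.prems(2) \<open>p \<in> U\<close> by (auto simp: differentiable_def)
      then have "(v has_derivative D) (at p)"
        using assms(1) \<open>p \<in> U\<close> Suc.prems(1) by (rule has_derivative_transform_within_open)
      then show ?thesis by (auto simp: differentiable_def)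
    qed
    moreover have "Ck_on k U (partial i v)" for i
    proof (rule Suc.IH[of "partial i u"])
      show "partial i u q = partial i v q" if "q \<in> U" for q
        using assms(1) that Suc.prems(1) by (rule partial_cong_on)
      show "Ck_on k U (partial i u)"
        using Suc.prems(2) by simp
    qed
    ultimately show ?case by simp
  qed
  from this[of u v] this[of v u] show ?thesis
    using assms(2) by auto
qed

lemma Ck_on_SucI:
  "(\<And>p. p \<in> U \<Longrightarrow> u differentiable (at p)) \<Longrightarrow> (\<And>i. Ck_on k U (partial i u)) \<Longrightarrow> Ck_on (Suc k) U u"
  by simp

lemma Ck_on_SucD:
  assumes "Ck_on (Suc k) U u"
  shows "p \<in> U \<Longrightarrow> u differentiable (at p)" "Ck_on k U (partial i u)"
  using assms by simp_all

lemma Ck_on_Suc_imp: "Ck_on (Suc k) U u \<Longrightarrow> Ck_on k U u"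
proof (induction k arbitrary: u)
  case 0
  then show ?case
    by (auto intro!: continuous_at_imp_continuous_on differentiable_imp_continuous_within)
next
  case (Suc k)
  have "u differentiable (at p)" if "p \<in> U" for p
    using Suc.prems that by (rule Ck_on_SucD)
  moreover have "Ck_on k U (partial i u)" for i
    using Suc.prems by (intro Suc.IH Ck_on_SucD)
  ultimately show ?case by (rule Ck_on_SucI)
qed

lemma Ck_on_const: "Ck_on k U (\<lambda>p. c)"
proof (induction k arbitrary: c)
  case (Suc k)
  have "partial i (\<lambda>p. c) = (\<lambda>p. 0)" for i :: 'a
    by (rule ext) simp
  then show ?case using Suc by simp
qed simp

lemma Ck_on_add:
  assumes "open U" "Ck_on k U u" "Ck_on k U v"
  shows "Ck_on k U (\<lambda>p. u p + v p)"
  using assms(2,3)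
proof (induction k arbitrary: u v)
  case (Suc k)
  have "Ck_on k U (partial i (\<lambda>p. u p + v p)) \<longleftrightarrow> Ck_on k U (\<lambda>p. partial i u p + partial i v p)" for i
    using Suc.prems by (intro Ck_on_cong[OF assms(1)]) (simp add: partial_add)
  then show ?case using Suc by auto
qed (auto intro: continuous_on_add)

text \<open>By the product rule the first partial derivatives of a product of \<open>C\<^sup>k\<^sup>+\<^sup>1\<close> functions are sums of
  products of \<open>C\<^sup>k\<close> functions, which closes the induction.\<close>

lemma Ck_on_mult:
  assumes "open U" "Ck_on k U u" "Ck_on k U v"
  shows "Ck_on k U (\<lambda>p. u p * v p)"
  using assms(2,3)
proof (induction k arbitrary: u v)
  case (Suc k)
  have "Ck_on k U (\<lambda>p. partial i u p * v p + u p * partial i v p)" for i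
    using Suc.prems Suc.prems[THEN Ck_on_Suc_imp]
    by (intro Ck_on_add[OF assms(1)] Suc.IH) auto
  moreover have "Ck_on k U (partial i (\<lambda>p. u p * v p)) \<longleftrightarrow>
      Ck_on k U (\<lambda>p. partial i u p * v p + u p * partial i v p)" for i
    using Suc.prems by (intro Ck_on_cong[OF assms(1)]) (simp add: partial_mult)
  ultimately show ?case using Suc.prems by (auto intro: differentiable_mult)
qed (auto intro: continuous_on_mult)

text \<open>The derivative of \<open>1 / v\<close> is a product of a derivative of \<open>v\<close> and two copies of \<open>1 / v\<close> itself,
  so one degree of differentiability of \<open>1 / v\<close> gives the next one.\<close>

lemma Ck_on_inverse:
  assumes "open U" "Ck_on k U v" "\<And>p. p \<in> U \<Longrightarrow> v p \<noteq> 0"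
  shows "Ck_on k U (\<lambda>p. 1 / v p)"
  using assms(2)
proof (induction k)
  case 0
  then show ?case using assms(3) by (auto intro!: continuous_intros)
next
  case (Suc k)
  have "Ck_on k U (\<lambda>p. (-1) * (partial i v p * ((1 / v p) * (1 / v p))))" for i
    using Suc Ck_on_Suc_imp[OF Suc.prems]
    by (intro Ck_on_mult[OF assms(1)] Ck_on_const Suc.IH) auto
  moreover have "Ck_on k U (partial i (\<lambda>p. 1 / v p)) \<longleftrightarrow>
      Ck_on k U (\<lambda>p. (-1) * (partial i v p * ((1 / v p) * (1 / v p))))" for i
    using Suc.prems assms(3)
    by (intro Ck_on_cong[OF assms(1)]) (simp add: partial_divide power2_eq_square)
  ultimately show ?case using Suc.prems assms(3) by (auto intro!: differentiable_divide)
qed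

lemma smooth_on_const: "smooth_on U (\<lambda>p. c)"
  by (simp add: smooth_on_def Ck_on_const)

lemma smooth_on_add:
  "open U \<Longrightarrow> smooth_on U u \<Longrightarrow> smooth_on U v \<Longrightarrow> smooth_on U (\<lambda>p. u p + v p)"
  by (simp add: smooth_on_def Ck_on_add)

lemma smooth_on_mult:
  "open U \<Longrightarrow> smooth_on U u \<Longrightarrow> smooth_on U v \<Longrightarrow> smooth_on U (\<lambda>p. u p * v p)"
  by (simp add: smooth_on_def Ck_on_mult)

lemma smooth_on_diff:
  "open U \<Longrightarrow> smooth_on U u \<Longrightarrow> smooth_on U v \<Longrightarrow> smooth_on U (\<lambda>p. u p - v p)"
  using smooth_on_add[of U u "\<lambda>p. (-1) * v p"] smooth_on_mult[of U "\<lambda>_. -1" v] smooth_on_const[of U "-1"]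
  by simp

lemma smooth_on_power:
  "open U \<Longrightarrow> smooth_on U u \<Longrightarrow> smooth_on U (\<lambda>p. u p ^ n)"
  by (induction n) (simp_all add: smooth_on_const smooth_on_mult)

lemma smooth_on_divide:
  assumes "open U" "smooth_on U u" "smooth_on U v" "\<And>p. p \<in> U \<Longrightarrow> v p \<noteq> 0"
  shows "smooth_on U (\<lambda>p. u p / v p)"
proof -
  have "smooth_on U (\<lambda>p. 1 / v p)"
    using assms by (simp add: smooth_on_def Ck_on_inverse)
  from smooth_on_mult[OF assms(1,2) this] show ?thesis by simp
qed

lemma smooth_on_partial:
  assumes "smooth_on U u"
  shows "smooth_on U (partial i u)"
  unfolding smooth_on_def
proof
  fix k
  have "Ck_on (Suc k) U u" using assms by (simp only: smooth_on_def)
  then show "Ck_on k U (partial i u)" by (rule Ck_on_SucD)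
qed

lemma smooth_on_differentiable:
  assumes "smooth_on U u" "p \<in> U"
  shows "u differentiable (at p)"
proof -
  have "Ck_on (Suc 0) U u" using assms by (simp only: smooth_on_def)
  then show ?thesis using assms(2) by (rule Ck_on_SucD)
qed

lemma smooth_on_nth: "smooth_on U (\<lambda>p. p $ j)"
  unfolding smooth_on_def
proof
  fix k show "Ck_on k U (\<lambda>p. p $ j)"
  proof (cases k)
    case 0
    then show ?thesis by (auto intro: continuous_intros)
  next
    case (Suc l)
    have line: "partial i (\<lambda>p. p $ j) = (\<lambda>p. axis i 1 $ j)" for i
      by (rule ext, rule partial_eqI) (auto intro!: derivative_eq_intros)
    have "linear (\<lambda>p :: real^'a. p $ j)"
      by (rule linearI) simp_all
    then show ?thesis
      unfolding Suc by (intro Ck_on_SucI linear_imp_differentiable) (simp_all only: line Ck_on_const)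
  qed
qed

section \<open>Symmetry of mixed partial derivatives\<close>

text \<open>Two applications of the mean value theorem: to the difference of \<open>u\<close> along the two edges of the
  square in direction \<open>i\<close>, and then to \<open>partial i u\<close> in direction \<open>j\<close>. The left-hand side is symmetric
  in \<open>i\<close> and \<open>j\<close>, and this symmetry carries over to the mixed derivatives in the limit.\<close>

lemma second_difference_mean_value:
  fixes u :: "real^'n \<Rightarrow> real"
  assumes "0 < h"
    and box: "\<And>s t. 0 \<le> s \<Longrightarrow> s \<le> h \<Longrightarrow> 0 \<le> t \<Longrightarrow> t \<le> h \<Longrightarrow>
      p + s *\<^sub>R axis i 1 + t *\<^sub>R axis j 1 \<in> U"
    and u: "\<And>q. q \<in> U \<Longrightarrow> u differentiable (at q)"
    and pu: "\<And>q. q \<in> U \<Longrightarrow> partial i u differentiable (at q)"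
  shows "\<exists>s t. 0 < s \<and> s < h \<and> 0 < t \<and> t < h \<and>
    u (p + h *\<^sub>R axis i 1 + h *\<^sub>R axis j 1) - u (p + h *\<^sub>R axis i 1) - u (p + h *\<^sub>R axis j 1) + u p
      = h\<^sup>2 * partial j (partial i u) (p + s *\<^sub>R axis i 1 + t *\<^sub>R axis j 1)"
proof -
  let ?p = "\<lambda>s t. p + s *\<^sub>R axis i 1 + t *\<^sub>R axis j (1::real)"
  define \<phi> where "\<phi> s = u (?p s h) - u (?p s 0)" for s
  have \<phi>: "(\<phi> has_real_derivative partial i u (?p s h) - partial i u (?p s 0)) (at s)"
    if "0 \<le> s" "s \<le> h" for s
  proof -
    have "((\<lambda>s. u (?p s t)) has_real_derivative partial i u (?p s t)) (at s)"
      if "0 \<le> t" "t \<le> h" for t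
      using has_partial[of u "p + t *\<^sub>R axis j 1" s i] u[OF box[OF \<open>0 \<le> s\<close> \<open>s \<le> h\<close> that]]
      by (simp add: add_ac)
    from DERIV_diff[OF this[of h] this[of 0]] show ?thesis
      using \<open>0 < h\<close> unfolding \<phi>_def by simp
  qed
  obtain s where s: "0 < s" "s < h"
      "\<phi> h - \<phi> 0 = (h - 0) * (partial i u (?p s h) - partial i u (?p s 0))"
    using MVT2[OF \<open>0 < h\<close> \<phi>] by blast
  have "((\<lambda>t. partial i u (?p s t)) has_real_derivative partial j (partial i u) (?p s t)) (at t)"
    if "0 \<le> t" "t \<le> h" for t
    using has_partial[of "partial i u" "p + s *\<^sub>R axis i 1" t j] pu[OF box[of s t]] s(1,2) that by simp
  from MVT2[OF \<open>0 < h\<close> this] obtain t where t: "0 < t" "t < h"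
      "partial i u (?p s h) - partial i u (?p s 0) = (h - 0) * partial j (partial i u) (?p s t)"
    by blast
  have "\<phi> h - \<phi> 0 = h\<^sup>2 * partial j (partial i u) (?p s t)"
    unfolding s(3) t(3) by (simp add: power2_eq_square)
  then have "u (p + h *\<^sub>R axis i 1 + h *\<^sub>R axis j 1) - u (p + h *\<^sub>R axis i 1)
      - u (p + h *\<^sub>R axis j 1) + u p = h\<^sup>2 * partial j (partial i u) (?p s t)"
    unfolding \<phi>_def scaleR_zero_left add_0_right by linarith
  then show ?thesis
    using s(1,2) t(1,2) by blast
qed

text \<open>Schwarz's theorem. If the two mixed derivatives differed at \<open>p\<close>, then by continuity they would be
  separated on a small square at \<open>p\<close>; but on every such square both of them attain the second
  difference divided by \<open>h\<^sup>2\<close>.\<close>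

lemma partial_commute:
  fixes u :: "real^'n \<Rightarrow> real"
  assumes U: "open U" "p \<in> U" and C2: "Ck_on 2 U u"
  shows "partial i (partial j u) p = partial j (partial i u) p"
proof (rule ccontr)
  assume neq: "partial i (partial j u) p \<noteq> partial j (partial i u) p"
  define e where "e = \<bar>partial i (partial j u) p - partial j (partial i u) p\<bar> / 2"
  have e: "e > 0" using neq by (simp add: e_def)
  have C: "u differentiable (at q)" "partial k u differentiable (at q)"
    "continuous_on U (partial l (partial k u))" if "q \<in> U" for q k l
    using C2 that by (simp_all add: eval_nat_numeral)
  have near: "eventually (\<lambda>q. dist (partial l (partial k u) q) (partial l (partial k u) p) < e) (nhds p)" for k l
  proof -
    have "isCont (partial l (partial k u)) p"
      using C(3)[OF U(2)] U by (simp add: continuous_on_eq_continuous_at)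
    then have "(partial l (partial k u) \<longlongrightarrow> partial l (partial k u) p) (nhds p)"
      unfolding isCont_def tendsto_at_iff_tendsto_nhds .
    then show ?thesis using e by (rule tendstoD)
  qed
  have "eventually (\<lambda>q. q \<in> U \<and>
      dist (partial i (partial j u) q) (partial i (partial j u) p) < e \<and>
      dist (partial j (partial i u) q) (partial j (partial i u) p) < e) (nhds p)"
    using U by (intro eventually_conj near) (auto simp: eventually_nhds)
  then obtain r where r: "r > 0" "\<And>q. dist q p < r \<Longrightarrow> q \<in> U \<and>
      dist (partial i (partial j u) q) (partial i (partial j u) p) < e \<and>
      dist (partial j (partial i u) q) (partial j (partial i u) p) < e"
    unfolding eventually_nhds_metric by blast
  (* Two sides of the square add up to 2 * r / 3, so the square stays in the ball of radius r. *)
  define h where "h = r / 3"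
  have h: "h > 0" using r by (simp add: h_def)
  have small: "dist (p + s *\<^sub>R axis k 1 + t *\<^sub>R axis l 1) p < r"
    if "0 \<le> s" "s \<le> h" "0 \<le> t" "t \<le> h" for s t k l
  proof -
    have "norm (s *\<^sub>R axis k 1 + t *\<^sub>R axis l (1::real) :: real^'n) \<le> s + t"
      using that by (intro order.trans[OF norm_triangle_ineq]) (simp add: norm_axis_1)
    also have "\<dots> < r" using that r(1) by (simp add: h_def)
    finally show ?thesis by (simp add: dist_norm add.assoc)
  qed
  have box: "p + s *\<^sub>R axis k 1 + t *\<^sub>R axis l 1 \<in> U"
    if "0 \<le> s" "s \<le> h" "0 \<le> t" "t \<le> h" for s t k l
    using r(2)[OF small[OF that]] by blast
  obtain s t where st: "0 < s" "s < h" "0 < t" "t < h"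
    "u (p + h *\<^sub>R axis i 1 + h *\<^sub>R axis j 1) - u (p + h *\<^sub>R axis i 1) - u (p + h *\<^sub>R axis j 1) + u p
      = h\<^sup>2 * partial j (partial i u) (p + s *\<^sub>R axis i 1 + t *\<^sub>R axis j 1)"
    using second_difference_mean_value[OF h, of p i j U u] box C by blast
  obtain s' t' where st': "0 < s'" "s' < h" "0 < t'" "t' < h"
    "u (p + h *\<^sub>R axis j 1 + h *\<^sub>R axis i 1) - u (p + h *\<^sub>R axis j 1) - u (p + h *\<^sub>R axis i 1) + u p
      = h\<^sup>2 * partial i (partial j u) (p + s' *\<^sub>R axis j 1 + t' *\<^sub>R axis i 1)"
    using second_difference_mean_value[OF h, of p j i U u] box C by blast
  have eq: "p + h *\<^sub>R axis j 1 + h *\<^sub>R axis i 1 = p + h *\<^sub>R axis i 1 + h *\<^sub>R axis j 1"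
    by (simp add: add_ac)
  have "h\<^sup>2 * partial j (partial i u) (p + s *\<^sub>R axis i 1 + t *\<^sub>R axis j 1)
      = h\<^sup>2 * partial i (partial j u) (p + s' *\<^sub>R axis j 1 + t' *\<^sub>R axis i 1)"
    using st(5) st'(5) unfolding eq by linarith
  then have "partial j (partial i u) (p + s *\<^sub>R axis i 1 + t *\<^sub>R axis j 1)
      = partial i (partial j u) (p + s' *\<^sub>R axis j 1 + t' *\<^sub>R axis i 1)"
    using h by simp
  moreover have "dist (partial j (partial i u) (p + s *\<^sub>R axis i 1 + t *\<^sub>R axis j 1)) (partial j (partial i u) p) < e"
    using r(2)[OF small[of s t i j]] st by simp
  moreover have "dist (partial i (partial j u) (p + s' *\<^sub>R axis j 1 + t' *\<^sub>R axis i 1)) (partial i (partial j u) p) < e"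
    using r(2)[OF small[of s' t' j i]] st' by simp
  ultimately show False by (simp add: e_def dist_real_def abs_if split: if_splits)
qed

lemma smooth_on_partial_commute:
  assumes "open U" "p \<in> U" "smooth_on U u"
  shows "partial i (partial j u) p = partial j (partial i u) p"
  using assms(1,2)
proof (rule partial_commute)
  show "Ck_on 2 U u" using assms(3) by (simp only: smooth_on_def)
qed

lemma partial_rotate:
  assumes "open U" "p \<in> U" "smooth_on U u"
  shows "partial i (partial j (partial k u)) p = partial j (partial k (partial i u)) p"
proof -
  have "partial i (partial j (partial k u)) p = partial j (partial i (partial k u)) p"
    by (intro smooth_on_partial_commute[OF assms(1,2)] smooth_on_partial assms(3))
  also have "\<dots> = partial j (partial k (partial i u)) p"
    by (intro partial_cong_on[OF assms(1,2)] smooth_on_partial_commute[OF assms(1)] assms(3))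
  finally show ?thesis .
qed

section \<open>The coordinates of the spacetime\<close>

lemma xy_nth [simp]: "xy p $ 1 = p $ 3" "xy p $ 2 = p $ 4"
  by (simp_all add: xy_def)

lemma linear_xy: "linear xy"
  by (rule linearI) (simp_all add: vec_eq_iff forall_2)

lemma continuous_on_xy: "continuous_on U xy"
  using linear_xy by (rule linear_continuous_on_compose[OF continuous_on_id, simplified])

lemma differentiable_xy: "xy differentiable (at p)"
  using linear_xy by (simp add: linear_imp_differentiable)

lemma coordinate_line [simp]:
  "(p + s *\<^sub>R axis 1 1) $ 2 = p $ 2" "xy (p + s *\<^sub>R axis 1 1) = xy p"
  "(p + s *\<^sub>R axis 2 1) $ 2 = p $ 2 + s" "xy (p + s *\<^sub>R axis 2 1) = xy p"
  "(p + s *\<^sub>R axis 3 1) $ 2 = p $ 2" "xy (p + s *\<^sub>R axis 3 1) = xy p + s *\<^sub>R axis 1 1"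
  "(p + s *\<^sub>R axis 4 1) $ 2 = p $ 2" "xy (p + s *\<^sub>R axis 4 1) = xy p + s *\<^sub>R axis 2 1"
  by (simp_all add: vec_eq_iff forall_2 axis_def)

text \<open>Every field of the spacetime is a function of \<open>r\<close> and of the point \<open>(x, y)\<close> of \<open>\<Omega>\<close>; this reduces
  its four coordinate derivatives to one-dimensional derivatives in \<open>r\<close> and to derivatives on \<open>\<Omega>\<close>.\<close>

lemma partial_r_xy:
  "partial 1 (\<lambda>p. F (p $ 2) (xy p)) p = 0"
  "partial 2 (\<lambda>p. F (p $ 2) (xy p)) p = deriv (\<lambda>r. F r (xy p)) (p $ 2)"
  "partial 3 (\<lambda>p. F (p $ 2) (xy p)) p = partial 1 (F (p $ 2)) (xy p)"
  "partial 4 (\<lambda>p. F (p $ 2) (xy p)) p = partial 2 (F (p $ 2)) (xy p)"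
proof -
  show "partial 2 (\<lambda>p. F (p $ 2) (xy p)) p = deriv (\<lambda>r. F r (xy p)) (p $ 2)"
    by (subst deriv_shift_0) (simp add: partial_def o_def)
qed (simp_all only: partial_def coordinate_line deriv_const)

lemma Ck_on_xy:
  assumes "xy ` U \<subseteq> \<Omega>" "Ck_on k \<Omega> u"
  shows "Ck_on k U (\<lambda>p. u (xy p))"
  using assms(2)
proof (induction k arbitrary: u)
  case 0
  then show ?case
    using assms(1) by (auto intro: continuous_on_compose2[OF _ continuous_on_xy])
next
  case (Suc k)
  have "Ck_on k U (partial i (\<lambda>p. u (xy p)))" for i
  proof -
    have "partial i (\<lambda>p. u (xy p)) =
        (if i = 3 then (\<lambda>p. dx u (xy p)) else if i = 4 then (\<lambda>p. dy u (xy p)) else (\<lambda>p. 0))"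
      using exhaust_4[of i]
      by (elim disjE) (simp_all add: fun_eq_iff partial_r_xy[where F = "\<lambda>r. u"])
    then show ?thesis
      using Suc by (auto simp: Ck_on_const)
  qed
  moreover have "(\<lambda>p. u (xy p)) differentiable (at p)" if "p \<in> U" for p
    using Suc.prems assms(1) that differentiable_chain_at[OF differentiable_xy, of u p]
    by (auto simp: o_def)
  ultimately show ?case by simp
qed

lemma smooth_on_xy: "xy ` U \<subseteq> \<Omega> \<Longrightarrow> smooth_on \<Omega> u \<Longrightarrow> smooth_on U (\<lambda>p. u (xy p))"
  by (simp add: smooth_on_def Ck_on_xy)

lemma open_rt_domain:
  assumes "open I" "open J" "open \<Omega>"
  shows "open (rt_domain I J \<Omega>)"
proof -
  have "rt_domain I J \<Omega> = (\<lambda>p. p $ 1) -` I \<inter> (\<lambda>p. p $ 2) -` J \<inter> xy -` \<Omega>"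
    by (auto simp: rt_domain_def)
  then show ?thesis
    using assms by (auto intro!: open_Int open_vimage continuous_on_xy continuous_intros)
qed

section \<open>Ricci tensor and Lie derivative in general\<close>

lemma matrix_inv_eqI:
  fixes A B :: "real^'n^'n"
  assumes "A ** B = mat 1" "B ** A = mat 1"
  shows "matrix_inv A = B"
proof -
  have "A ** matrix_inv A = mat 1 \<and> matrix_inv A ** A = mat 1"
    unfolding matrix_inv_def by (rule someI[of _ B]) (use assms in simp)
  then have "matrix_inv A = matrix_inv A ** (A ** B)"
    using assms by simp
  also have "\<dots> = (matrix_inv A ** A) ** B"
    by (rule matrix_mul_assoc)
  also have "\<dots> = B"
    using \<open>A ** matrix_inv A = mat 1 \<and> matrix_inv A ** A = mat 1\<close> by simp
  finally show ?thesis .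
qed

text \<open>Lowering the first index of the curvature with \<open>g\<close> and contracting it with the inverse of \<open>g\<close> cancel
  each other, so the Ricci tensor is a trace of the curvature with raised first index.\<close>

lemma ricci_eq_trace:
  assumes "transpose (g p) = g p" "invertible (g p)"
  shows "ricci g p $ q $ r = (\<Sum>s\<in>UNIV.
     partial r (christoffel g s q s) p - partial s (christoffel g s q r) p
       + (\<Sum>\<beta>\<in>UNIV. christoffel g \<beta> q s p * christoffel g s \<beta> r p)
       - (\<Sum>\<beta>\<in>UNIV. christoffel g \<beta> q r p * christoffel g s \<beta> s p))"
proof -
  define R where "R \<alpha> s =
     partial r (christoffel g \<alpha> q s) p - partial s (christoffel g \<alpha> q r) p
       + (\<Sum>\<beta>\<in>UNIV. christoffel g \<beta> q s p * christoffel g \<alpha> \<beta> r p)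
       - (\<Sum>\<beta>\<in>UNIV. christoffel g \<beta> q r p * christoffel g \<alpha> \<beta> s p)" for \<alpha> s
  have inv: "ginv g p ** g p = mat 1" "g p ** ginv g p = mat 1"
    using assms(2) someI_ex[of "\<lambda>B. g p ** B = mat 1 \<and> B ** g p = mat 1"]
    by (auto simp: ginv_def matrix_inv_def invertible_def)
  have contract: "(\<Sum>h\<in>UNIV. ginv g p $ h $ s * g p $ h $ \<alpha>) = (if \<alpha> = s then 1 else 0)" for s \<alpha>
  proof -
    have "g p $ h $ \<alpha> = g p $ \<alpha> $ h" for h
      using arg_cong[OF assms(1), of "\<lambda>A. A $ \<alpha> $ h"] by (simp add: transpose_def)
    then have "(\<Sum>h\<in>UNIV. ginv g p $ h $ s * g p $ h $ \<alpha>) = (g p ** ginv g p) $ \<alpha> $ s"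
      by (simp add: matrix_matrix_mult_def mult.commute)
    then show ?thesis by (simp add: inv mat_def)
  qed
  have "ricci g p $ q $ r =
      (\<Sum>h\<in>UNIV. \<Sum>s\<in>UNIV. \<Sum>\<alpha>\<in>UNIV. ginv g p $ h $ s * g p $ h $ \<alpha> * R \<alpha> s)"
    by (simp add: ricci_def riemann_def R_def sum_distrib_left mult.assoc)
  also have "\<dots> = (\<Sum>s\<in>UNIV. \<Sum>\<alpha>\<in>UNIV. \<Sum>h\<in>UNIV. ginv g p $ h $ s * g p $ h $ \<alpha> * R \<alpha> s)"
    by (subst sum.swap, intro sum.cong refl sum.swap)
  also have "\<dots> = (\<Sum>s\<in>UNIV. \<Sum>\<alpha>\<in>UNIV. (if \<alpha> = s then 1 else 0) * R \<alpha> s)"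
    by (simp add: contract flip: sum_distrib_right)
  also have "\<dots> = (\<Sum>s\<in>UNIV. R s s)"
    by (simp add: if_distrib[of "\<lambda>x. x * _"] cong: if_cong)
  finally show ?thesis by (simp add: R_def)
qed

text \<open>The terms of the Lie derivative that contain derivatives of the field drop out for a field with
  constant components.\<close>

lemma lie_derivative_const:
  "lie_derivative (\<lambda>p. v) T p $ i $ j = (\<Sum>k\<in>UNIV. v $ k * partial k (\<lambda>p. T p $ i $ j) p)"
  by (simp add: lie_derivative_def)

section \<open>Metric and Christoffel symbols as functions of \<open>r\<close> and \<open>(x, y)\<close>\<close>


text \<open>The metric with the coordinates \<open>r\<close> and \<open>q = (x, y)\<close> as separate arguments, so that it can be
  differentiated in one of them while the other one is held fixed.\<close>

definition rt_matrix :: "real \<Rightarrow> real \<Rightarrow> real \<Rightarrow> (real^2 \<Rightarrow> real) \<Rightarrow> real \<Rightarrow> real^2 \<Rightarrow> real^4^4" where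
  "rt_matrix a b d f r q =
     vector [vector [- 2 * (a - 2 * b * r - d / r), 1, 0, 0],
             vector [1, 0, 0, 0],
             vector [0, 0, - (r\<^sup>2 / (f q)\<^sup>2), 0],
             vector [0, 0, 0, - (r\<^sup>2 / (f q)\<^sup>2)]]"

lemma rt_metric_eq: "rt_metric a b d f p = rt_matrix a b d f (p $ 2) (xy p)"
  by (simp add: rt_metric_def rt_matrix_def Let_def)

definition rt_matrix_dr :: "real \<Rightarrow> real \<Rightarrow> (real^2 \<Rightarrow> real) \<Rightarrow> real \<Rightarrow> real^2 \<Rightarrow> real^4^4" where
  "rt_matrix_dr b d f r q =
     vector [vector [4 * b - 2 * d / r\<^sup>2, 0, 0, 0],
             vector [0, 0, 0, 0],
             vector [0, 0, - (2 * r / (f q)\<^sup>2), 0],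
             vector [0, 0, 0, - (2 * r / (f q)\<^sup>2)]]"

definition rt_matrix_dq :: "2 \<Rightarrow> (real^2 \<Rightarrow> real) \<Rightarrow> real \<Rightarrow> real^2 \<Rightarrow> real^4^4" where
  "rt_matrix_dq m f r q =
     (let h = 2 * r\<^sup>2 * partial m f q / (f q)^3 in
     vector [vector [0, 0, 0, 0],
             vector [0, 0, 0, 0],
             vector [0, 0, h, 0],
             vector [0, 0, 0, h]])"

definition rt_inverse :: "real \<Rightarrow> real \<Rightarrow> real \<Rightarrow> (real^2 \<Rightarrow> real) \<Rightarrow> real \<Rightarrow> real^2 \<Rightarrow> real^4^4" where
  "rt_inverse a b d f r q =
     vector [vector [0, 1, 0, 0],
             vector [1, 2 * (a - 2 * b * r - d / r), 0, 0],
             vector [0, 0, - ((f q)\<^sup>2 / r\<^sup>2), 0],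
             vector [0, 0, 0, - ((f q)\<^sup>2 / r\<^sup>2)]]"

lemma rt_matrix_inverse:
  assumes "r \<noteq> 0" "f q \<noteq> 0"
  shows "rt_matrix a b d f r q ** rt_inverse a b d f r q = mat 1"
    "rt_inverse a b d f r q ** rt_matrix a b d f r q = mat 1"
  using assms
  by (simp_all add: vec_eq_iff forall_4 matrix_matrix_mult_def sum_4 rt_matrix_def rt_inverse_def mat_def)

text \<open>The entry at \<open>k\<close>, \<open>i\<close>, \<open>j\<close> has upper index \<open>k\<close>. Here \<open>P\<close> is the coefficient \<open>g\<^sub>1\<^sub>1\<close>, and \<open>X\<close> and \<open>Y\<close>
  are the logarithmic derivatives of \<open>f\<close>: the lower right blocks of the third and fourth matrix are the
  Christoffel symbols of the conformally flat metric \<open>(dx\<^sup>2 + dy\<^sup>2) / f\<^sup>2\<close>.\<close>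

definition rt_christoffel ::
  "real \<Rightarrow> real \<Rightarrow> real \<Rightarrow> (real^2 \<Rightarrow> real) \<Rightarrow> real \<Rightarrow> real^2 \<Rightarrow> real^4^4^4" where
  "rt_christoffel a b d f r q =
     (let P = - 2 * (a - 2 * b * r - d / r); P' = 4 * b - 2 * d / r\<^sup>2;
          h = r / (f q)\<^sup>2; X = dx f q / f q; Y = dy f q / f q in
      vector [vector [vector [- P' / 2, 0, 0, 0],
                      vector [0, 0, 0, 0],
                      vector [0, 0, h, 0],
                      vector [0, 0, 0, h]],
              vector [vector [P * P' / 2, P' / 2, 0, 0],
                      vector [P' / 2, 0, 0, 0],
                      vector [0, 0, - P * h, 0],
                      vector [0, 0, 0, - P * h]],
              vector [vector [0, 0, 0, 0],
                      vector [0, 0, 1 / r, 0],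
                      vector [0, 1 / r, - X, - Y],
                      vector [0, 0, - Y, X]],
              vector [vector [0, 0, 0, 0],
                      vector [0, 0, 0, 1 / r],
                      vector [0, 0, Y, - X],
                      vector [0, 1 / r, - X, - Y]]])"

definition rt_christoffel_dr ::
  "real \<Rightarrow> real \<Rightarrow> real \<Rightarrow> (real^2 \<Rightarrow> real) \<Rightarrow> real \<Rightarrow> real^2 \<Rightarrow> real^4^4^4" where
  "rt_christoffel_dr a b d f r q =
     (let P = - 2 * (a - 2 * b * r - d / r); P' = 4 * b - 2 * d / r\<^sup>2; P'' = 4 * d / r^3;
          h = 1 / (f q)\<^sup>2; k = - (P + r * P') / (f q)\<^sup>2 in
      vector [vector [vector [- P'' / 2, 0, 0, 0],
                      vector [0, 0, 0, 0],
                      vector [0, 0, h, 0],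
                      vector [0, 0, 0, h]],
              vector [vector [(P' * P' + P * P'') / 2, P'' / 2, 0, 0],
                      vector [P'' / 2, 0, 0, 0],
                      vector [0, 0, k, 0],
                      vector [0, 0, 0, k]],
              vector [vector [0, 0, 0, 0],
                      vector [0, 0, - (1 / r\<^sup>2), 0],
                      vector [0, - (1 / r\<^sup>2), 0, 0],
                      vector [0, 0, 0, 0]],
              vector [vector [0, 0, 0, 0],
                      vector [0, 0, 0, - (1 / r\<^sup>2)],
                      vector [0, 0, 0, 0],
                      vector [0, - (1 / r\<^sup>2), 0, 0]]])"

definition rt_christoffel_dq ::
  "2 \<Rightarrow> real \<Rightarrow> real \<Rightarrow> real \<Rightarrow> (real^2 \<Rightarrow> real) \<Rightarrow> real \<Rightarrow> real^2 \<Rightarrow> real^4^4^4" where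
  "rt_christoffel_dq m a b d f r q =
     (let P = - 2 * (a - 2 * b * r - d / r);
          h = - (2 * r * partial m f q / (f q)^3);
          X = (partial m (dx f) q * f q - dx f q * partial m f q) / (f q)\<^sup>2;
          Y = (partial m (dy f) q * f q - dy f q * partial m f q) / (f q)\<^sup>2 in
      vector [vector [vector [0, 0, 0, 0],
                      vector [0, 0, 0, 0],
                      vector [0, 0, h, 0],
                      vector [0, 0, 0, h]],
              vector [vector [0, 0, 0, 0],
                      vector [0, 0, 0, 0],
                      vector [0, 0, - P * h, 0],
                      vector [0, 0, 0, - P * h]],
              vector [vector [0, 0, 0, 0],
                      vector [0, 0, 0, 0],
                      vector [0, 0, - X, - Y],
                      vector [0, 0, - Y, X]],
              vector [vector [0, 0, 0, 0],
                      vector [0, 0, 0, 0],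
                      vector [0, 0, Y, - X],
                      vector [0, 0, - X, - Y]]])"

lemma rt_matrix_has_dr:
  assumes "r \<noteq> 0" "f q \<noteq> 0"
  shows "((\<lambda>r. rt_matrix a b d f r q $ i $ j) has_real_derivative rt_matrix_dr b d f r q $ i $ j) (at r)"
proof -
  have "\<forall>i j. ((\<lambda>r. rt_matrix a b d f r q $ i $ j) has_real_derivative rt_matrix_dr b d f r q $ i $ j) (at r)"
    unfolding forall_4 rt_matrix_def rt_matrix_dr_def vector_4
    using assms by (auto intro!: derivative_eq_intros simp: field_simps power2_eq_square)
  then show ?thesis by blast
qed

lemma rt_matrix_partial:
  assumes "f differentiable (at q)" "f q \<noteq> 0"
  shows "partial m (\<lambda>q. rt_matrix a b d f r q $ i $ j) q = rt_matrix_dq m f r q $ i $ j"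
proof -
  have "\<forall>i j. ((\<lambda>s. rt_matrix a b d f r (q + s *\<^sub>R axis m 1) $ i $ j)
      has_real_derivative rt_matrix_dq m f r q $ i $ j) (at 0)"
    unfolding forall_4 rt_matrix_def rt_matrix_dq_def Let_def vector_4
    using assms(2)
    by (auto intro!: derivative_eq_intros has_partial_0 assms simp: field_simps eval_nat_numeral)
  then show ?thesis by (intro partial_eqI) blast
qed

lemma rt_christoffel_has_dr:
  assumes "r \<noteq> 0" "f q \<noteq> 0"
  shows "((\<lambda>r. rt_christoffel a b d f r q $ k $ i $ j) has_real_derivative
    rt_christoffel_dr a b d f r q $ k $ i $ j) (at r)"
proof -
  have "\<forall>k i j. ((\<lambda>r. rt_christoffel a b d f r q $ k $ i $ j) has_real_derivative
      rt_christoffel_dr a b d f r q $ k $ i $ j) (at r)"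
    unfolding forall_4 rt_christoffel_def rt_christoffel_dr_def Let_def vector_4
    using assms by (auto intro!: derivative_eq_intros) (auto simp: field_simps eval_nat_numeral)
  then show ?thesis by blast
qed

lemma rt_christoffel_partial:
  assumes "f differentiable (at q)" "dx f differentiable (at q)" "dy f differentiable (at q)" "f q \<noteq> 0"
  shows "partial m (\<lambda>q. rt_christoffel a b d f r q $ k $ i $ j) q =
    rt_christoffel_dq m a b d f r q $ k $ i $ j"
proof -
  have "\<forall>k i j. ((\<lambda>s. rt_christoffel a b d f r (q + s *\<^sub>R axis m 1) $ k $ i $ j)
      has_real_derivative rt_christoffel_dq m a b d f r q $ k $ i $ j) (at 0)"
    unfolding forall_4 rt_christoffel_def rt_christoffel_dq_def Let_def vector_4
    using assms(4)
    by (auto intro!: derivative_eq_intros has_partial_0 assms simp: field_simps eval_nat_numeral)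
  then show ?thesis by (intro partial_eqI) blast
qed

definition rt_ricci :: "real \<Rightarrow> real \<Rightarrow> real \<Rightarrow> (real^2 \<Rightarrow> real) \<Rightarrow> real \<Rightarrow> real^2 \<Rightarrow> real^4^4" where
  "rt_ricci a b d f r q =
     (let S12 = - (4 * b / r); S33 = (F1 f q - 2 * a + 8 * b * r) / (f q)\<^sup>2 in
      vector [vector [- (8 * b * (d + r * (- a + 2 * b * r)) / r\<^sup>2), S12, 0, 0],
              vector [S12, 0, 0, 0],
              vector [0, 0, S33, 0],
              vector [0, 0, 0, S33]])"

section \<open>Curvature of the Robinson--Trautman metric\<close>

locale robinson_trautman =
  fixes a b d :: real and I J :: "real set" and \<Omega> :: "(real^2) set" and f :: "real^2 \<Rightarrow> real"
  assumes open_I: "open I" and open_J: "open J" and zero_notin_J: "0 \<notin> J" and open_\<Omega>: "open \<Omega>"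
    and smooth_f: "smooth_on \<Omega> f" and f_nonzero: "\<And>q. q \<in> \<Omega> \<Longrightarrow> f q \<noteq> 0"
begin

abbreviation M where "M \<equiv> rt_domain I J \<Omega>"
abbreviation g where "g \<equiv> rt_metric a b d f"

lemma open_M: "open M"
  by (intro open_rt_domain open_I open_J open_\<Omega>)

lemma M_D:
  assumes "p \<in> M"
  shows "p $ 2 \<noteq> 0" "xy p \<in> \<Omega>" "f (xy p) \<noteq> 0"
  using assms zero_notin_J f_nonzero by (auto simp: rt_domain_def)

lemma differentiable_f:
  assumes "q \<in> \<Omega>"
  shows "f differentiable (at q)" "partial i f differentiable (at q)"
    "partial j (partial i f) differentiable (at q)"
  by (intro smooth_on_differentiable[OF _ assms] smooth_on_partial smooth_f)+

lemma partial_metric: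
  assumes "p \<in> M"
  shows "partial 1 (\<lambda>p. g p $ i $ j) p = 0"
    "partial 2 (\<lambda>p. g p $ i $ j) p = rt_matrix_dr b d f (p $ 2) (xy p) $ i $ j"
    "partial 3 (\<lambda>p. g p $ i $ j) p = rt_matrix_dq 1 f (p $ 2) (xy p) $ i $ j"
    "partial 4 (\<lambda>p. g p $ i $ j) p = rt_matrix_dq 2 f (p $ 2) (xy p) $ i $ j"
  unfolding rt_metric_eq
    partial_r_xy[where F = "\<lambda>r q. rt_matrix a b d f r q $ i $ j"]
  using M_D[OF assms] differentiable_f
  by (simp_all add: DERIV_imp_deriv[OF rt_matrix_has_dr] rt_matrix_partial)

lemma christoffel_eq:
  assumes "p \<in> M"
  shows "christoffel g k i j p = rt_christoffel a b d f (p $ 2) (xy p) $ k $ i $ j"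
proof -
  have "\<forall>k i j. christoffel g k i j p = rt_christoffel a b d f (p $ 2) (xy p) $ k $ i $ j"
    using M_D[OF assms]
    unfolding forall_4 christoffel_def sum_4 partial_metric[OF assms]
    unfolding ginv_def rt_metric_eq
    by (simp add: matrix_inv_eqI[OF rt_matrix_inverse] rt_inverse_def rt_matrix_dr_def
        rt_matrix_dq_def rt_christoffel_def Let_def)
      (simp add: field_simps eval_nat_numeral)
  then show ?thesis by blast
qed

lemma partial_christoffel:
  assumes "p \<in> M"
  shows "partial 1 (christoffel g k i j) p = 0"
    "partial 2 (christoffel g k i j) p = rt_christoffel_dr a b d f (p $ 2) (xy p) $ k $ i $ j"
    "partial 3 (christoffel g k i j) p = rt_christoffel_dq 1 a b d f (p $ 2) (xy p) $ k $ i $ j"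
    "partial 4 (christoffel g k i j) p = rt_christoffel_dq 2 a b d f (p $ 2) (xy p) $ k $ i $ j"
proof -
  have eq: "partial l (christoffel g k i j) p =
      partial l (\<lambda>p. rt_christoffel a b d f (p $ 2) (xy p) $ k $ i $ j) p" for l
    by (rule partial_cong_on[OF open_M assms christoffel_eq])
  show "partial 1 (christoffel g k i j) p = 0"
    "partial 2 (christoffel g k i j) p = rt_christoffel_dr a b d f (p $ 2) (xy p) $ k $ i $ j"
    "partial 3 (christoffel g k i j) p = rt_christoffel_dq 1 a b d f (p $ 2) (xy p) $ k $ i $ j"
    "partial 4 (christoffel g k i j) p = rt_christoffel_dq 2 a b d f (p $ 2) (xy p) $ k $ i $ j"
    unfolding eq partial_r_xy[where F = "\<lambda>r q. rt_christoffel a b d f r q $ k $ i $ j"]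
    using M_D[OF assms] differentiable_f
    by (simp_all add: DERIV_imp_deriv[OF rt_christoffel_has_dr] rt_christoffel_partial)
qed

lemma partial_commute_f: "q \<in> \<Omega> \<Longrightarrow> partial i (partial j f) q = partial j (partial i f) q"
  using open_\<Omega> _ smooth_f by (rule smooth_on_partial_commute)

text \<open>The entries \<open>(3, 4)\<close> of the two sides agree only because the mixed second derivatives of \<open>f\<close> do:
  the trace contains \<open>f\<^sub>x\<^sub>y\<close> and \<open>f\<^sub>y\<^sub>x\<close> with opposite signs.\<close>

lemma ricci_eq:
  assumes "p \<in> M"
  shows "ricci g p $ i $ j = rt_ricci a b d f (p $ 2) (xy p) $ i $ j"
proof -
  note nz = M_D[OF assms]
  have "transpose (g p) = g p"
    by (simp add: rt_metric_eq rt_matrix_def transpose_def vec_eq_iff forall_4)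
  moreover have "invertible (g p)"
    using rt_matrix_inverse[of "p $ 2" f "xy p" a b d] nz
    unfolding invertible_def rt_metric_eq by blast
  ultimately have ric: "ricci g p $ i $ j = (\<Sum>s\<in>UNIV.
     partial j (christoffel g s i s) p - partial s (christoffel g s i j) p
       + (\<Sum>\<beta>\<in>UNIV. christoffel g \<beta> i s p * christoffel g s \<beta> j p)
       - (\<Sum>\<beta>\<in>UNIV. christoffel g \<beta> i j p * christoffel g s \<beta> s p))" for i j
    by (rule ricci_eq_trace)
  have comm: "dy (dx f) (xy p) = dx (dy f) (xy p)"
    by (rule partial_commute_f) (rule nz)
  have "\<forall>i j. ricci g p $ i $ j = rt_ricci a b d f (p $ 2) (xy p) $ i $ j"
    unfolding ric forall_4 sum_4 partial_christoffel[OF assms] christoffel_eq[OF assms]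
    unfolding rt_ricci_def rt_christoffel_def rt_christoffel_dr_def rt_christoffel_dq_def Let_def
      vector_4 F1_def comm
    using nz by (simp add: field_simps eval_nat_numeral)
  then show ?thesis by blast
qed

lemma has_partial_F1:
  assumes "q \<in> \<Omega>"
  shows "((\<lambda>s. F1 f (q + s *\<^sub>R axis m 1)) has_real_derivative
      2 * dx f q * partial m (dx f) q + 2 * dy f q * partial m (dy f) q
      - partial m f q * (dx (dx f) q + dy (dy f) q)
      - f q * (partial m (dx (dx f)) q + partial m (dy (dy f)) q)) (at 0)"
  unfolding F1_def
  by (auto intro!: derivative_eq_intros has_partial_0 differentiable_f[OF assms])

text \<open>The quotient rule produces \<open>f \<partial>F\<^sub>1 - 2 (F\<^sub>1 - 2 a + 8 b r) \<partial>f\<close> over \<open>f\<^sup>3\<close>, and this numerator is what the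
  polynomials \<open>F\<^sub>1\<^sub>1\<close> and \<open>F\<^sub>1\<^sub>3\<close> stand for. Since they order the mixed derivatives with \<open>x\<close> first, the case of
  \<open>\<partial>/\<partial>x\<close> has to reorder \<open>f\<^sub>y\<^sub>x\<close> and \<open>f\<^sub>y\<^sub>y\<^sub>x\<close>.\<close>

lemma partial_ricci_angular:
  assumes "q \<in> \<Omega>"
  shows "dx (\<lambda>q. (F1 f q - 2 * a + 8 * b * r) / (f q)\<^sup>2) q = F11 a b f r q / (f q)^3" (is ?X)
    and "dy (\<lambda>q. (F1 f q - 2 * a + 8 * b * r) / (f q)\<^sup>2) q = F13 a b f r q / (f q)^3" (is ?Y)
proof -
  note nz = f_nonzero[OF assms]
  note intros = derivative_eq_intros has_partial_F1[OF assms] has_partial_0 differentiable_f[OF assms]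
  have comm: "dx (dy f) q = dy (dx f) q"
    by (rule partial_commute_f[OF assms])
  have rotate: "dx (dy (dy f)) q = dy (dy (dx f)) q"
    by (rule partial_rotate[OF open_\<Omega> assms smooth_f])
  have quotient: "partial m (\<lambda>q. (F1 f q - 2 * a + 8 * b * r) / (f q)\<^sup>2) q =
      (f q * (2 * dx f q * partial m (dx f) q + 2 * dy f q * partial m (dy f) q
          - partial m f q * (dx (dx f) q + dy (dy f) q)
          - f q * (partial m (dx (dx f)) q + partial m (dy (dy f)) q))
        - 2 * (F1 f q - 2 * a + 8 * b * r) * partial m f q) / (f q)^3" for m
    by (rule partial_eqI)
      (use nz in \<open>auto intro!: intros simp: field_simps eval_nat_numeral\<close>)
  show ?X
    unfolding quotient
    by (rule arg_cong[of _ _ "\<lambda>x. x / _"])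
      (simp add: F11_def F1_def comm rotate algebra_simps eval_nat_numeral)
  show ?Y
    unfolding quotient
    by (rule arg_cong[of _ _ "\<lambda>x. x / _"])
      (simp add: F13_def F1_def algebra_simps eval_nat_numeral)
qed

lemma partial_ricci:
  assumes "p \<in> M"
  shows "partial 3 (\<lambda>p. ricci g p $ i $ j) p =
      (if i = j \<and> i \<in> {3, 4} then F11 a b f (p $ 2) (xy p) / (f (xy p))^3 else 0)"
    "partial 4 (\<lambda>p. ricci g p $ i $ j) p =
      (if i = j \<and> i \<in> {3, 4} then F13 a b f (p $ 2) (xy p) / (f (xy p))^3 else 0)"
proof -
  have eq: "partial l (\<lambda>p. ricci g p $ i $ j) p =
      partial l (\<lambda>p. rt_ricci a b d f (p $ 2) (xy p) $ i $ j) p" for l i j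
    by (rule partial_cong_on[OF open_M assms ricci_eq])
  have "\<forall>i j. dx (\<lambda>q. rt_ricci a b d f r q $ i $ j) (xy p) =
      (if i = j \<and> i \<in> {3, 4} then F11 a b f r (xy p) / (f (xy p))^3 else 0)"
    "\<forall>i j. dy (\<lambda>q. rt_ricci a b d f r q $ i $ j) (xy p) =
      (if i = j \<and> i \<in> {3, 4} then F13 a b f r (xy p) / (f (xy p))^3 else 0)" for r
    unfolding forall_4 rt_ricci_def Let_def vector_4
    by (simp_all add: partial_ricci_angular[OF M_D(2)[OF assms]])
  then show "partial 3 (\<lambda>p. ricci g p $ i $ j) p =
      (if i = j \<and> i \<in> {3, 4} then F11 a b f (p $ 2) (xy p) / (f (xy p))^3 else 0)"
    "partial 4 (\<lambda>p. ricci g p $ i $ j) p =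
      (if i = j \<and> i \<in> {3, 4} then F13 a b f (p $ 2) (xy p) / (f (xy p))^3 else 0)"
    unfolding eq partial_r_xy[where F = "\<lambda>r q. rt_ricci a b d f r q $ i $ j"] by blast+
qed

lemma lie_derivative_ricci:
  assumes "p \<in> M"
  shows "lie_derivative (\<lambda>p. \<mu> *\<^sub>R axis 3 1 + \<nu> *\<^sub>R axis 4 1) (ricci g) p $ i $ j =
    (if i = j \<and> i \<in> {3, 4}
     then (\<nu> * F13 a b f (p $ 2) (xy p) + \<mu> * F11 a b f (p $ 2) (xy p)) / (f (xy p))^3 else 0)"
  unfolding lie_derivative_const
  by (auto simp: sum_4 axis_def partial_ricci[OF assms] add_divide_distrib)

lemma smooth_on_M:
  "smooth_on M (\<lambda>p. f (xy p))" "smooth_on M (\<lambda>p. partial i f (xy p))"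
  "smooth_on M (\<lambda>p. partial i (partial j f) (xy p))"
  "smooth_on M (\<lambda>p. partial i (partial j (partial k f)) (xy p))"
  by (rule smooth_on_xy[of _ \<Omega>], use M_D(2) in blast, intro smooth_on_partial smooth_f)+

lemma smooth_on_factor:
  assumes "\<And>p. p \<in> M \<Longrightarrow> F1 f (xy p) - 2 * a + 4 * b * p $ 2 \<noteq> 0"
  shows "smooth_on M (\<lambda>p. (\<nu> * F13 a b f (p $ 2) (xy p) + \<mu> * F11 a b f (p $ 2) (xy p))
    / (f (xy p) * (F1 f (xy p) - 2 * a + 4 * b * p $ 2)))"
proof (rule smooth_on_divide[OF open_M])
  show "f (xy p) * (F1 f (xy p) - 2 * a + 4 * b * p $ 2) \<noteq> 0" if "p \<in> M" for p
    using assms that M_D by simp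
qed (unfold F1_def F11_def F13_def,
  (intro smooth_on_add smooth_on_diff smooth_on_mult smooth_on_power smooth_on_const
    smooth_on_nth smooth_on_M open_M)+)

end

section \<open>Ricci inheritance\<close>

theorem corollary4p1:
  fixes a b d :: real and I J :: "real set" and \<Omega> :: "(real^2) set" and f :: "real^2 \<Rightarrow> real"
  assumes "open I" "is_interval I" "I \<noteq> {}"
    and "open J" "is_interval J" "J \<noteq> {}" "0 \<notin> J"
    and "open \<Omega>" "connected \<Omega>" "\<Omega> \<noteq> {}"
    and "smooth_on \<Omega> f" "\<forall>q\<in>\<Omega>. f q \<noteq> 0"
    and "b = 0"
    and "\<forall>p \<in> rt_domain I J \<Omega>. F1 f (xy p) - 2 * a + 4 * b * p $ 2 \<noteq> 0"
  shows "\<forall>\<mu>\<^sub>1 \<mu>\<^sub>2 :: real.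
    ricci_inheritance (rt_domain I J \<Omega>) (rt_metric a b d f)
      (\<lambda>p. \<mu>\<^sub>1 *\<^sub>R axis 3 1 + \<mu>\<^sub>2 *\<^sub>R axis 4 1)
      (\<lambda>p. (\<mu>\<^sub>2 * F13 a b f (p $ 2) (xy p) + \<mu>\<^sub>1 * F11 a b f (p $ 2) (xy p))
            / (f (xy p) * (F1 f (xy p) - 2 * a + 4 * b * p $ 2)))"
proof (intro allI)
  fix \<mu>\<^sub>1 \<mu>\<^sub>2 :: real
  interpret robinson_trautman a b d I J \<Omega> f
    using assms by unfold_locales auto
  let ?\<xi> = "\<lambda>p. \<mu>\<^sub>1 *\<^sub>R axis 3 1 + \<mu>\<^sub>2 *\<^sub>R axis 4 1"
  let ?lam = "\<lambda>p. (\<mu>\<^sub>2 * F13 a b f (p $ 2) (xy p) + \<mu>\<^sub>1 * F11 a b f (p $ 2) (xy p))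
            / (f (xy p) * (F1 f (xy p) - 2 * a + 4 * b * p $ 2))"
  note denom = assms(14)[rule_format]
  show "ricci_inheritance M g ?\<xi> ?lam"
    unfolding ricci_inheritance_def
  proof (intro conjI ballI)
    show "smooth_on M ?lam"
      using denom by (rule smooth_on_factor)
  next
    fix p assume p: "p \<in> M"
    have "f (xy p) \<noteq> 0" "F1 f (xy p) - 2 * a \<noteq> 0"
      using M_D(3)[OF p] denom[OF p] \<open>b = 0\<close> by simp_all
    then have "\<forall>i j. lie_derivative ?\<xi> (ricci g) p $ i $ j = ?lam p * ricci g p $ i $ j"
      unfolding lie_derivative_ricci[OF p] ricci_eq[OF p] rt_ricci_def Let_def forall_4 vector_4
      using \<open>b = 0\<close> by (simp add: eval_nat_numeral)
    then show "lie_derivative ?\<xi> (ricci g) p = ?lam p *\<^sub>R ricci g p"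
      by (simp add: vec_eq_iff)
  qed
qed

end
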